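(* Let $n\ge1$, $0<|p|<1$, and let $a_1,a_2,t\in\mathbb{C}^\ast$ be generic. Then the $\mathbb{C}$-linear space $H_n$ has a unique basis $E_r(z)=E_r(a_1,a_2;z)$ $(r=0,1,\ldots,n)$ such that $$E_r(\zeta^{(s)})=\delta_{rs}\qquad\text{for } 0\le r,s\le n,$$ where $\delta_{rs}$ is the Kronecker delta.
   Context: $W_n=(\mathbb{Z}/2\mathbb{Z})^n\rtimes\mathfrak{S}_n$ acts on the space $\mathcal{O}((\mathbb{C}^\ast)^n)$ of holomorphic functions on $(\mathbb{C}^\ast)^n$ through permutations of the variables $z_1,\ldots,z_n$ and inversions $z_i\mapsto z_i^{-1}$. The $p$-shift operator is $T_{p,z_i}f(z_1,\ldots,z_n)=f(z_1,\ldots,pz_i,\ldots,z_n)$. Define $$H_n=\{f\in\mathcal{O}((\mathbb{C}^\ast)^n)^{W_n}\mid T_{p,z_i}f(z)=f(z)/(pz_i^2)\ (i=1,\ldots,n)\},$$ the $W_n$-invariant holomorphic functions with this quasi-periodicity. It is a known fact that $\dim_{\mathbb{C}}H_n=n+1$. For $s=0,1,\ldots,n$ the reference point $\zeta^{(s)}=\zeta^{(s)}(a_1,a_2)\in(\mathbb{C}^\ast)^n$ is $$\zeta^{(s)}=(\underbrace{a_1,a_1t,\ldots,a_1t^{s-1}}_{s},\underbrace{a_2,a_2t,\ldots,a_2t^{n-s-1}}_{n-s}).$$ Generic means: $a_1a_2t^m\notin p^{\mathbb{Z}}$ for $0\le m\le n-1$, and $a_1a_2^{-1}t^m\notin p^{\mathbb{Z}}$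 for all integers $m$ with $|m|\le n-1$, where $p^{\mathbb{Z}}=\{p^k\mid k\in\mathbb{Z}\}$. *)

theory Defs
  imports
    "HOL-Analysis.Analysis"
    "HOL-Library.Function_Algebras"
begin

text \<open>
  Points of \<open>\<complex>\<^sup>n\<close> are vectors of type \<open>complex ^ 'n\<close> with \<open>n = CARD('n)\<close>. The linear order on
  the index type serves only to speak of the first, second, ... coordinate.
\<close>

definition index_pos :: "'n::{finite,linorder} \<Rightarrow> nat" where
  "index_pos i = card {j. j < i}"

definition torus :: "(complex ^ 'n::finite) set" where
  "torus = {z. \<forall>i. z $ i \<noteq> 0}"

text \<open>Holomorphic in several variables on an open set: Frechet differentiable at every point with a
  complex-linear derivative.\<close>

definition holomorphic_multi_on ::
    "(complex ^ 'n::finite \<Rightarrow> complex) \<Rightarrow> (complex ^ 'n) set \<Rightarrow> bool" where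
  "holomorphic_multi_on f U \<longleftrightarrow>
     (\<forall>z\<in>U. \<exists>D. (f has_derivative D) (at z) \<and> (\<forall>c v. D (c *s v) = c * D v))"

text \<open>A function on the torus is represented by its extension by \<open>0\<close> to the whole type, so that
  equality of functions on the torus is equality in HOL.\<close>

definition hol_torus :: "(complex ^ 'n::finite \<Rightarrow> complex) set" where
  "hol_torus = {f. holomorphic_multi_on f torus \<and> (\<forall>z. z \<notin> torus \<longrightarrow> f z = 0)}"

text \<open>The element of \<open>(\<int>/2)\<^sup>n \<rtimes> S\<^sub>n\<close> given by \<open>\<epsilon>\<close> and the permutation \<open>\<sigma>\<close>;
  \<open>\<epsilon> i\<close> tells whether the \<open>i\<close>-th coordinate of the result is inverted.\<close>

definition W_act :: "('n \<Rightarrow> bool) \<Rightarrow> ('n \<Rightarrow> 'n) \<Rightarrow> complex ^ 'n \<Rightarrow> complex ^ 'n::finite" where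
  "W_act \<epsilon> \<sigma> z = (\<chi> i. if \<epsilon> i then inverse (z $ \<sigma> i) else z $ \<sigma> i)"

definition W_invariant :: "(complex ^ 'n::finite \<Rightarrow> complex) \<Rightarrow> bool" where
  "W_invariant f \<longleftrightarrow>
     (\<forall>\<epsilon> \<sigma>. \<sigma> permutes (UNIV :: 'n set) \<longrightarrow> (\<forall>z\<in>torus. f (W_act \<epsilon> \<sigma> z) = f z))"

definition shift_op ::
    "complex \<Rightarrow> 'n \<Rightarrow> (complex ^ 'n::finite \<Rightarrow> complex) \<Rightarrow> complex ^ 'n \<Rightarrow> complex" where
  "shift_op p i f z = f (\<chi> j. if j = i then p * z $ j else z $ j)"

definition H_space :: "complex \<Rightarrow> (complex ^ 'n::finite \<Rightarrow> complex) set" where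
  "H_space p = {f \<in> hol_torus. W_invariant f \<and>
     (\<forall>i. \<forall>z\<in>torus. shift_op p i f z = f z / (p * (z $ i)\<^sup>2))}"

definition ref_point :: "complex \<Rightarrow> complex \<Rightarrow> complex \<Rightarrow> nat \<Rightarrow> complex ^ 'n::{finite,linorder}" where
  "ref_point a1 a2 t s =
     (\<chi> i. let k = index_pos i in if k < s then a1 * t ^ k else a2 * t ^ (k - s))"

definition generic_params ::
    "nat \<Rightarrow> complex \<Rightarrow> complex \<Rightarrow> complex \<Rightarrow> complex \<Rightarrow> bool" where
  "generic_params n p t a1 a2 \<longleftrightarrow>
     (\<forall>m::nat. m \<le> n - 1 \<longrightarrow> a1 * a2 * t ^ m \<notin> range (\<lambda>k::int. p powi k)) \<and>
     (\<forall>m::int. \<bar>m\<bar> \<le> int n - 1 \<longrightarrow> a1 * inverse a2 * t powi m \<notin> range (\<lambda>k::int. p powi k))"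

definition cscale :: "complex \<Rightarrow> ('a \<Rightarrow> complex) \<Rightarrow> 'a \<Rightarrow> complex" where
  "cscale c f = (\<lambda>z. c * f z)"

global_interpretation cfun: vector_space "cscale :: complex \<Rightarrow> ('a \<Rightarrow> complex) \<Rightarrow> 'a \<Rightarrow> complex"
  by unfold_locales (auto simp: cscale_def fun_eq_iff algebra_simps)

definition is_basis_family :: "'i set \<Rightarrow> ('i \<Rightarrow> 'a \<Rightarrow> complex) \<Rightarrow> ('a \<Rightarrow> complex) set \<Rightarrow> bool" where
  "is_basis_family I E V \<longleftrightarrow>
     inj_on E I \<and> cfun.independent (E ` I) \<and> cfun.span (E ` I) = V"

lemma subspace_H_space: "cfun.subspace (H_space p :: (complex ^ 'n::finite \<Rightarrow> complex) set)"
proof (rule cfun.subspaceI)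
  show "0 \<in> (H_space p :: (complex ^ 'n \<Rightarrow> complex) set)"
    by (auto simp: H_space_def hol_torus_def holomorphic_multi_on_def W_invariant_def shift_op_def
        zero_fun_def intro!: exI[of _ "\<lambda>_. 0"])
next
  fix f g :: "complex ^ 'n \<Rightarrow> complex"
  assume fg: "f \<in> H_space p" "g \<in> H_space p"
  have "holomorphic_multi_on (f + g) torus"
    unfolding holomorphic_multi_on_def
  proof
    fix z :: "complex ^ 'n" assume "z \<in> torus"
    then obtain D D' where "(f has_derivative D) (at z)" "\<And>c v. D (c *s v) = c * D v"
        "(g has_derivative D') (at z)" "\<And>c v. D' (c *s v) = c * D' v"
      using fg unfolding H_space_def hol_torus_def holomorphic_multi_on_def by blast
    then show "\<exists>D. (f + g has_derivative D) (at z) \<and> (\<forall>c v. D (c *s v) = c * D v)"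
      by (intro exI[of _ "\<lambda>v. D v + D' v"])
        (auto simp: plus_fun_def distrib_left intro: has_derivative_add)
  qed
  with fg show "f + g \<in> H_space p"
    by (auto simp: H_space_def hol_torus_def W_invariant_def shift_op_def add_divide_distrib)
next
  fix c and f :: "complex ^ 'n \<Rightarrow> complex"
  assume f: "f \<in> H_space p"
  have "holomorphic_multi_on (cscale c f) torus"
    unfolding holomorphic_multi_on_def
  proof
    fix z :: "complex ^ 'n" assume "z \<in> torus"
    then obtain D where "(f has_derivative D) (at z)" "\<And>c v. D (c *s v) = c * D v"
      using f unfolding H_space_def hol_torus_def holomorphic_multi_on_def by blast
    then show "\<exists>D. (cscale c f has_derivative D) (at z) \<and> (\<forall>c v. D (c *s v) = c * D v)"
      by (intro exI[of _ "\<lambda>v. c * D v"])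
        (auto simp: cscale_def intro: has_derivative_mult_right)
  qed
  with f show "cscale c f \<in> H_space p"
    by (auto simp: H_space_def hol_torus_def W_invariant_def shift_op_def cscale_def)
qed

end

theory Submission
  imports
    Defs
    "HOL-Complex_Analysis.Laurent_Convergence"
    "HOL-Combinatorics.Permutations"
begin

text \<open>
  Everything rests on one variable. Let \<open>H1\<close> be the space of holomorphic \<open>g\<close> on \<open>\<complex>\<^sup>*\<close> with
  \<open>g (1/z) = g z\<close> and \<open>g (p z) = g z / (p z\<^sup>2)\<close>; it contains the theta products
  \<open>\<theta> (u z) \<theta> (u / z)\<close>, whose zeros are exactly \<open>u\<^sup>\<plusminus>\<^sup>1 p\<^sup>\<int>\<close>. If these zeros are simple, any other
  \<open>g \<in> H1\<close> vanishing at \<open>u\<close> vanishes at all of them, so the quotient is a holomorphic \<open>p\<close>-periodic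
  function on \<open>\<complex>\<^sup>*\<close>, hence bounded, hence constant by Liouville's theorem. So \<open>H1\<close> is spanned by two
  functions, and an element of \<open>H1\<close> that vanishes at two points \<open>x\<close>, \<open>y\<close> with
  \<open>x y, x / y \<notin> p\<^sup>\<int>\<close> is zero (\<open>H1_two_zeros_imp_zero\<close>).

  In \<open>n\<close> variables this gives injectivity of the evaluation \<open>f \<mapsto> (f \<zeta>\<^sup>(\<^sup>s\<^sup>))\<^sub>s\<close> on \<open>H\<^sub>n\<close>
  (\<open>H_space_zero_if_zero_at_ref_points\<close>). Suppose \<open>f\<close> vanishes at all reference points. By
  downward induction on \<open>i + j\<close>, \<open>f\<close> vanishes at every \<open>z\<close> among whose coordinates occur
  \<open>a\<^sub>1, \<dots>, a\<^sub>1 t\<^sup>i\<^sup>-\<^sup>1\<close> and \<open>a\<^sub>2, \<dots>, a\<^sub>2 t\<^sup>j\<^sup>-\<^sup>1\<close>. For \<open>i + j = n\<close> such a \<open>z\<close> is a permutation of a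
  reference point. For \<open>i + j < n\<close>, pick a coordinate that is not needed for the match: as a
  function of that coordinate \<open>f\<close> lies in \<open>H1\<close>, and by induction it vanishes at \<open>a\<^sub>1 t\<^sup>i\<close> and
  \<open>a\<^sub>2 t\<^sup>j\<close>. The products and quotients of these two numbers avoid \<open>p\<^sup>\<int>\<close> precisely by genericity, as
  \<open>i + j \<le> n - 1\<close> and \<open>\<bar>i - j\<bar> \<le> n - 1\<close>. The case \<open>i = j = 0\<close> is \<open>f = 0\<close>.

  Surjectivity of the evaluation is a dimension count (\<open>H_space_interpolation\<close>): the \<open>n + 1\<close> products
  \<open>\<Prod>\<^sub>i (e\<^sub>1 (z\<^sub>i) + m e\<^sub>2 (z\<^sub>i))\<close>, \<open>0 \<le> m \<le> n\<close>, where \<open>e\<^sub>1, e\<^sub>2 \<in> H1\<close> vanish at \<open>a\<^sub>1\<close> and \<open>a\<^sub>2\<close>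
  respectively, lie in \<open>H\<^sub>n\<close> and are linearly independent, since at points with \<open>s\<close> coordinates \<open>a\<^sub>1\<close>
  and \<open>n - s\<close> coordinates \<open>a\<^sub>2\<close> their values form a Vandermonde matrix up to nonzero factors.
  So evaluation is an isomorphism of \<open>H\<^sub>n\<close> onto \<open>\<complex>\<^sup>n\<^sup>+\<^sup>1\<close>, and \<open>E\<^sub>r\<close> is the preimage of the standard basis.
\<close>

section \<open>The theta function of a nome\<close>

locale nome =
  fixes p :: complex
  assumes p_pos: "0 < norm p" and p_less: "norm p < 1"
begin

lemma p_nonzero [simp]: "p \<noteq> 0"
  using p_pos by auto

definition p_powers :: "complex set" where
  "p_powers = range (\<lambda>k::int. p powi k)"

lemma powi_in_p_powers [simp]: "p powi k \<in> p_powers"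
  by (auto simp: p_powers_def)

lemma p_powers_mult: "x \<in> p_powers \<Longrightarrow> y \<in> p_powers \<Longrightarrow> x * y \<in> p_powers"
  by (auto simp: p_powers_def simp flip: power_int_add)

lemma p_powers_inverse: "x \<in> p_powers \<Longrightarrow> inverse x \<in> p_powers"
  by (auto simp: p_powers_def simp flip: power_int_minus)

lemma p_powers_inverse_iff: "inverse x \<in> p_powers \<longleftrightarrow> x \<in> p_powers"
  using p_powers_inverse[of x] p_powers_inverse[of "inverse x"] by auto

lemma p_powers_nonzero: "x \<in> p_powers \<Longrightarrow> x \<noteq> 0"
  by (auto simp: p_powers_def)

lemma p_powi_eq_1D:
  assumes "p powi k = 1"
  shows "k = 0"
proof (rule ccontr)
  assume "k \<noteq> 0"
  have "norm p powi k = 1"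
    using assms by (metis norm_one norm_power_int)
  then have "norm p powr k = 1"
    using p_pos by (simp add: powr_real_of_int')
  then show False
    using \<open>k \<noteq> 0\<close> p_pos p_less by (simp add: powr_def)
qed

definition qpoch :: "complex \<Rightarrow> complex" where
  "qpoch x = (\<Prod>k. 1 - p ^ k * x)"

lemma convergent_qpoch: "convergent_prod (\<lambda>k. 1 - p ^ k * x)"
proof -
  have "summable (\<lambda>k. norm x * norm p ^ k)"
    using p_less by (intro summable_mult summable_geometric) auto
  then have "abs_convergent_prod (\<lambda>k. 1 - p ^ k * x)"
    unfolding abs_convergent_prod_conv_summable by (simp add: norm_mult norm_power mult.commute)
  then show ?thesis
    by (rule abs_convergent_prod_imp_convergent_prod)
qed

lemma qpoch_has_prod: "(\<lambda>k. 1 - p ^ k * x) has_prod qpoch x"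
  unfolding qpoch_def by (rule convergent_prod_has_prod) (rule convergent_qpoch)

text \<open>
  The functional equation of the infinite \<open>q\<close>-Pochhammer symbol \<open>(x; p)\<^sub>\<infinity>\<close>, stated as a product so
  that it also records the zero at \<open>x = 1\<close>.
\<close>

lemma qpoch_rec: "qpoch x = (1 - x) * qpoch (p * x)"
proof -
  have "(\<lambda>k. 1 - p ^ k * x) has_prod ((\<Prod>k<1. 1 - p ^ k * x) * (\<Prod>k. 1 - p ^ (k + 1) * x))"
    by (rule has_prod_ignore_initial_segment') (rule convergent_qpoch)
  then have "(\<lambda>k. 1 - p ^ k * x) has_prod ((1 - x) * qpoch (p * x))"
    by (simp add: qpoch_def mult_ac)
  then show ?thesis
    using qpoch_has_prod has_prod_unique2 by blast
qed

lemma qpoch_eq_0D: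
  assumes "qpoch x = 0"
  obtains k :: nat where "p ^ k * x = 1"
  using has_prod_eq_0_iff[OF qpoch_has_prod, of x] assms by auto

lemma qpoch_holomorphic: "qpoch holomorphic_on UNIV"
proof -
  define P where "P = (\<lambda>N x. \<Prod>k<N. 1 - p ^ k * x)"
  have unif: "uniform_limit (cball 0 R) P qpoch sequentially" for R
  proof -
    have "uniformly_convergent_on (cball 0 R) P"
      unfolding P_def
    proof (rule uniformly_convergent_on_prod')
      show "uniformly_convergent_on (cball 0 R) (\<lambda>N x. \<Sum>n<N. norm (1 - p ^ n * x - 1))"
      proof (rule Weierstrass_m_test')
        show "summable (\<lambda>n. R * norm p ^ n)"
          using p_less by (intro summable_mult summable_geometric) auto
        fix n x assume "x \<in> cball (0::complex) R"
        then show "norm (norm (1 - p ^ n * x - 1)) \<le> R * norm p ^ n"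
          by (auto simp: norm_mult norm_power mult.commute intro: mult_right_mono)
      qed
    qed (auto intro!: continuous_intros)
    then obtain g where g: "uniform_limit (cball 0 R) P g sequentially"
      by (auto simp: uniformly_convergent_on_def)
    also have "?this \<longleftrightarrow> uniform_limit (cball 0 R) P qpoch sequentially"
    proof (intro uniform_limit_cong)
      fix x :: complex assume "x \<in> cball 0 R"
      with g have "(\<lambda>n. P (Suc n) x) \<longlonglongrightarrow> g x"
        by (metis tendsto_uniform_limitI filterlim_sequentially_Suc)
      moreover have "(\<lambda>n. P (Suc n) x) \<longlonglongrightarrow> qpoch x"
        using convergent_prod_LIMSEQ[OF convergent_qpoch[of x]]
        by (simp add: P_def lessThan_Suc_atMost qpoch_def)
      ultimately show "g x = qpoch x"
        using tendsto_unique by force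
    qed auto
    finally show ?thesis .
  qed
  show ?thesis
  proof (rule holomorphic_uniform_sequence)
    fix x :: complex
    have "uniform_limit (cball x 1) P qpoch sequentially"
      by (rule uniform_limit_on_subset[OF unif[of "norm x + 1"]]) (simp add: cball_subset_cball_iff)
    then show "\<exists>d>0. cball x d \<subseteq> UNIV \<and> uniform_limit (cball x d) P qpoch sequentially"
      by (intro exI[of _ 1]) auto
  qed (auto intro!: holomorphic_intros simp: P_def)
qed

lemma holomorphic_on_qpoch [holomorphic_intros]:
  assumes "f holomorphic_on A"
  shows "(\<lambda>z. qpoch (f z)) holomorphic_on A"
  using holomorphic_on_compose_gen[OF assms qpoch_holomorphic] by (auto simp: o_def)

definition theta :: "complex \<Rightarrow> complex" where
  "theta x = qpoch x * qpoch (p / x)"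

lemma theta_mult_p:
  assumes "x \<noteq> 0"
  shows "theta (p * x) = - theta x / x"
proof (cases "x = 1")
  case True
  then show ?thesis
    using qpoch_rec[of 1] by (simp add: theta_def)
next
  case False
  have "qpoch (p * x) = qpoch x / (1 - x)"
    using qpoch_rec[of x] False by simp
  moreover have "qpoch (p / (p * x)) = (1 - 1 / x) * qpoch (p / x)"
    using qpoch_rec[of "1 / x"] by simp
  ultimately have "theta (p * x) = qpoch x * qpoch (p / x) * ((1 - 1 / x) / (1 - x))"
    by (simp add: theta_def)
  also have "(1 - 1 / x) / (1 - x) = - 1 / x"
    using False assms by (simp add: field_simps)
  finally show ?thesis
    by (simp add: theta_def)
qed

text \<open>
  A convergent infinite product vanishes only if one of its factors does.
\<close>

lemma theta_nonzero:
  assumes "x \<notin> p_powers"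
  shows "theta x \<noteq> 0"
proof
  assume "theta x = 0"
  then consider "qpoch x = 0" | "qpoch (p / x) = 0"
    by (auto simp: theta_def)
  then show False
  proof cases
    case 1
    then obtain k where "p ^ k * x = 1"
      by (rule qpoch_eq_0D)
    then have "x = p powi (- int k)"
      by (simp add: power_int_minus field_simps)
    with assms show False by simp
  next
    case 2
    then obtain k where "p ^ k * (p / x) = 1"
      by (rule qpoch_eq_0D)
    then have "x = p powi (int (Suc k))"
      by (auto simp: field_simps power_int_add split: if_splits)
    with assms show False by (metis powi_in_p_powers)
  qed
qed

section \<open>The quasi-periodic functions of one variable\<close>

definition pair_theta :: "complex \<Rightarrow> complex \<Rightarrow> complex" where
  "pair_theta u z = theta (u * z) * theta (u / z)"

lemma pair_theta_nonzero:
  assumes "u * z \<notin> p_powers" "u / z \<notin> p_powers"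
  shows "pair_theta u z \<noteq> 0"
  using assms by (simp add: pair_theta_def theta_nonzero)

definition H1 :: "(complex \<Rightarrow> complex) set" where
  "H1 = {g. g holomorphic_on (- {0}) \<and>
     (\<forall>z. z \<noteq> 0 \<longrightarrow> g (inverse z) = g z \<and> g (p * z) = g z / (p * z\<^sup>2))}"

lemma H1_holomorphic: "g \<in> H1 \<Longrightarrow> g holomorphic_on (- {0})"
  and H1_inverse: "g \<in> H1 \<Longrightarrow> z \<noteq> 0 \<Longrightarrow> g (inverse z) = g z"
  and H1_shift: "g \<in> H1 \<Longrightarrow> z \<noteq> 0 \<Longrightarrow> g (p * z) = g z / (p * z\<^sup>2)"
  by (auto simp: H1_def)

lemma H1_has_deriv: "g \<in> H1 \<Longrightarrow> z \<noteq> 0 \<Longrightarrow> (g has_field_derivative deriv g z) (at z)"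
  using holomorphic_derivI[OF H1_holomorphic, of g z] by (simp add: open_Compl)

lemma H1_lincomb:
  assumes "f \<in> H1" "g \<in> H1"
  shows "(\<lambda>z. a * f z + b * g z) \<in> H1"
  using assms unfolding H1_def
  by (auto intro!: holomorphic_intros simp: add_divide_distrib)

lemma pair_theta_in_H1:
  assumes "u \<noteq> 0"
  shows "pair_theta u \<in> H1"
proof -
  have "pair_theta u holomorphic_on (- {0})"
    unfolding pair_theta_def theta_def
    using assms by (auto intro!: holomorphic_intros)
  moreover have "pair_theta u (inverse z) = pair_theta u z" for z
    by (simp add: pair_theta_def field_simps)
  moreover have "pair_theta u (p * z) = pair_theta u z / (p * z\<^sup>2)" if "z \<noteq> 0" for z
  proof -
    have 1: "theta (u * (p * z)) = - theta (u * z) / (u * z)"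
      using theta_mult_p[of "u * z"] assms that by (simp add: mult_ac)
    have "theta (u / z) = - theta (u / (p * z)) / (u / (p * z))"
      using theta_mult_p[of "u / (p * z)"] assms that by simp
    then have 2: "theta (u / (p * z)) = - (u / (p * z)) * theta (u / z)"
      using assms that by (simp add: field_simps)
    show ?thesis
      unfolding pair_theta_def 1 2 using assms that by (simp add: field_simps power2_eq_square)
  qed
  ultimately show ?thesis
    by (auto simp: H1_def)
qed

lemma pair_theta_self: "u \<noteq> 0 \<Longrightarrow> pair_theta u u = 0"
  using qpoch_rec[of 1] by (simp add: pair_theta_def theta_def)

text \<open>
  At a zero of \<open>g\<close>, differentiating \<open>g (p z) = g z / (p z\<^sup>2)\<close> leaves no term with the derivative of
  the factor \<open>1 / (p z\<^sup>2)\<close>. So simplicity of a zero is preserved under \<open>z \<mapsto> p z\<close>, and under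
  \<open>z \<mapsto> 1/z\<close> by the next lemma; moreover \<open>g' / e'\<close> at common zeros of \<open>g, e \<in> H1\<close> is
  \<open>p\<close>-periodic.
\<close>

lemma H1_deriv_shift:
  assumes "g \<in> H1" "z \<noteq> 0" "g z = 0"
  shows "deriv g (p * z) = deriv g z / (p\<^sup>2 * z\<^sup>2)"
proof -
  have "((\<lambda>w. g (p * w)) has_field_derivative deriv g (p * z) * p) (at z)"
    using assms by (intro DERIV_chain2[OF H1_has_deriv]) (auto intro!: derivative_eq_intros)
  moreover have "((\<lambda>w. g (p * w)) has_field_derivative deriv g z / (p * z\<^sup>2)) (at z)"
  proof (rule DERIV_cong_ev[THEN iffD2, OF refl _ refl])
    show "\<forall>\<^sub>F w in nhds z. g (p * w) = g w / (p * w\<^sup>2)"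
      using t1_space_nhds[of z 0] assms by (auto elim!: eventually_mono simp: H1_shift)
    show "((\<lambda>w. g w / (p * w\<^sup>2)) has_field_derivative deriv g z / (p * z\<^sup>2)) (at z)"
      using assms
      by (auto intro!: derivative_eq_intros H1_has_deriv simp: power2_eq_square field_simps)
  qed
  ultimately have "deriv g (p * z) * p = deriv g z / (p * z\<^sup>2)"
    by (rule DERIV_unique)
  then show ?thesis
    using assms by (simp add: field_simps power2_eq_square)
qed

lemma H1_deriv_inverse:
  assumes "g \<in> H1" "z \<noteq> 0"
  shows "deriv g (inverse z) = - deriv g z * z\<^sup>2"
proof -
  have "((\<lambda>w. g (inverse w)) has_field_derivative deriv g (inverse z) * (- inverse (z\<^sup>2))) (at z)"
    using assms
    by (intro DERIV_chain2[OF H1_has_deriv])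
       (auto intro!: derivative_eq_intros simp: power2_eq_square)
  moreover have "((\<lambda>w. g (inverse w)) has_field_derivative deriv g z) (at z)"
  proof (rule DERIV_cong_ev[THEN iffD2, OF refl _ refl])
    show "\<forall>\<^sub>F w in nhds z. g (inverse w) = g w"
      using t1_space_nhds[of z 0] assms by (auto elim!: eventually_mono simp: H1_inverse)
  qed (use assms in \<open>auto intro: H1_has_deriv\<close>)
  ultimately have "deriv g (inverse z) * (- inverse (z\<^sup>2)) = deriv g z"
    by (rule DERIV_unique)
  then show ?thesis
    using assms by (simp add: field_simps minus_equation_iff[of "deriv g (1 / z)"])
qed

end

section \<open>Zeros of functions in one variable\<close>

text \<open>
  At a simple zero \<open>w\<close> of \<open>e\<close> both difference quotients at \<open>w\<close> are holomorphic, and that of \<open>e\<close> does not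
  vanish at \<open>w\<close>. The quotient \<open>f / e\<close> is locally the quotient of these difference quotients, which at
  \<open>w\<close> itself takes the value \<open>f' w / e' w\<close>.
\<close>

lemma holomorphic_quotient_simple_zeros:
  assumes f: "f holomorphic_on S" and e: "e holomorphic_on S" and S: "open S"
    and zeros: "\<And>z. z \<in> S \<Longrightarrow> e z = 0 \<Longrightarrow> f z = 0 \<and> deriv e z \<noteq> 0"
  shows "(\<lambda>z. if e z = 0 then deriv f z / deriv e z else f z / e z) holomorphic_on S"
    (is "?h holomorphic_on S")
proof -
  have "?h analytic_on {w}" if w: "w \<in> S" for w
  proof (cases "e w = 0")
    case True
    define F where "F = (\<lambda>z. if z = w then deriv f w else (f z - f w) / (z - w))"
    define E where "E = (\<lambda>z. if z = w then deriv e w else (e z - e w) / (z - w))"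
    have hol: "F holomorphic_on S" "E holomorphic_on S"
      unfolding F_def E_def using f e S by (auto intro: pole_lemma_open)
    then have an: "F analytic_on {w}" "E analytic_on {w}"
      using S w analytic_on_open analytic_on_subset[of _ S "{w}"] by auto
    have Ew: "E w \<noteq> 0"
      using zeros[OF w True] by (simp add: E_def)
    have "isCont E w"
      using an(2) by (rule analytic_at_imp_isCont)
    then have "\<forall>\<^sub>F z in nhds w. E z \<noteq> 0"
      using Ew by (metis continuous_at tendsto_imp_eventually_ne tendsto_nhds_iff isCont_def)
    then have "\<forall>\<^sub>F z in nhds w. ?h z = F z / E z"
    proof eventually_elim
      case (elim z)
      then show ?case
        using zeros[OF w True] True by (auto simp: F_def E_def)
    qed
    moreover have "(\<lambda>z. F z / E z) analytic_on {w}"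
      using an Ew by (auto intro: analytic_on_divide)
    ultimately show ?thesis
      by (subst analytic_at_cong[OF _ refl])
  next
    case False
    have "isCont e w"
      using e S w by (metis continuous_on_eq_continuous_at holomorphic_on_imp_continuous_on)
    then have "\<forall>\<^sub>F z in nhds w. e z \<noteq> 0"
      using False by (metis continuous_at tendsto_imp_eventually_ne tendsto_nhds_iff isCont_def)
    then have "\<forall>\<^sub>F z in nhds w. ?h z = f z / e z"
      by eventually_elim auto
    moreover have "(\<lambda>z. f z / e z) analytic_on {w}"
      using f e S w False analytic_on_open analytic_on_subset[of _ S "{w}"]
      by (intro analytic_on_divide) auto
    ultimately show ?thesis
      by (subst analytic_at_cong[OF _ refl])
  qed
  then show ?thesis
    using S analytic_on_analytic_at analytic_on_open by blast
qed

context nome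
begin

lemma p_orbit_invariant:
  assumes step: "\<And>z. z \<noteq> 0 \<Longrightarrow> Q (p * z) \<longleftrightarrow> Q z"
    and "z \<noteq> 0" "q \<in> p_powers"
  shows "Q (q * z) \<longleftrightarrow> Q z"
proof -
  obtain k :: int where q: "q = p powi k"
    using assms by (auto simp: p_powers_def)
  have "Q (p powi k * z) \<longleftrightarrow> Q z"
  proof (induction k rule: int_induct[where k = 0])
    case base
    then show ?case by simp
  next
    case (step1 i)
    have "p powi (i + 1) * z = p * (p powi i * z)"
      by (simp add: power_int_add)
    then show ?case
      using step1 step[of "p powi i * z"] \<open>z \<noteq> 0\<close> by (metis mult_eq_0_iff p_nonzero power_int_not_zero)
  next
    case (step2 i)
    have "p powi i * z = p * (p powi (i - 1) * z)"
      by (simp add: power_int_diff)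
    then show ?case
      using step2 step[of "p powi (i - 1) * z"] \<open>z \<noteq> 0\<close>
      by (metis mult_eq_0_iff p_nonzero power_int_not_zero)
  qed
  then show ?thesis by (simp add: q)
qed

lemma pair_theta_zero_cases:
  assumes "pair_theta u z = 0" "u \<noteq> 0" "z \<noteq> 0"
  obtains q where "q \<in> p_powers" "z = q * u \<or> z = inverse (q * u)"
proof -
  consider "u * z \<in> p_powers" | "u / z \<in> p_powers"
    using pair_theta_nonzero assms by blast
  then show ?thesis
  proof cases
    case 1
    then show ?thesis
      using assms that[OF p_powers_inverse[OF 1]] by (simp add: field_simps)
  next
    case 2
    then show ?thesis
      using assms that[of "inverse (u / z)"] p_powers_inverse[of "u / z"] by simp
  qed
qed

lemma H1_zero_of_pair_theta:
  assumes "g \<in> H1" "g u = 0" "pair_theta u z = 0" "u \<noteq> 0" "z \<noteq> 0"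
  shows "g z = 0"
proof -
  obtain q where q: "q \<in> p_powers" "z = q * u \<or> z = inverse (q * u)"
    using pair_theta_zero_cases assms by blast
  have "g (q * u) = 0 \<longleftrightarrow> g u = 0"
    by (rule p_orbit_invariant) (use assms q in \<open>auto simp: H1_shift\<close>)
  then show ?thesis
    using q assms H1_inverse[of g "q * u"] p_powers_nonzero[of q] by auto
qed

text \<open>
  The zero of \<open>\<theta> (u / z)\<close> at \<open>z = u\<close> comes from the factor \<open>1 - u / z\<close> alone; the remaining factors there
  are \<open>\<theta> (u\<^sup>2) (p; p)\<^sub>\<infinity>\<^sup>2\<close>. For \<open>u\<^sup>2 \<in> p\<^sup>\<int>\<close> the two families of zeros would coincide and
  be double.
\<close>

lemma deriv_pair_theta_self:
  assumes "u \<noteq> 0" "u\<^sup>2 \<notin> p_powers"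
  shows "deriv (pair_theta u) u \<noteq> 0"
proof -
  define K where "K = (\<lambda>z. theta (u * z) * qpoch (p * u / z) * qpoch (p * z / u))"
  have fact: "pair_theta u z = (1 - u / z) * K z" for z
    using qpoch_rec[of "u / z"] by (simp add: pair_theta_def K_def theta_def)
  have "K holomorphic_on - {0}"
    unfolding K_def theta_def using assms by (auto intro!: holomorphic_intros)
  then have "(K has_field_derivative deriv K u) (at u)"
    using assms by (auto intro: holomorphic_derivI)
  then have "((\<lambda>z. (1 - u / z) * K z) has_field_derivative K u / u) (at u)"
    using assms by (auto intro!: derivative_eq_intros simp: field_simps)
  then have "deriv (pair_theta u) u = K u / u"
    unfolding fact[abs_def, symmetric] by (rule DERIV_imp_deriv)
  moreover have "qpoch p \<noteq> 0"
  proof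
    assume "qpoch p = 0"
    then obtain k where "p ^ k * p = 1"
      by (rule qpoch_eq_0D)
    then have "p powi (int k + 1) = 1"
      by (simp add: power_int_add)
    then show False
      using p_powi_eq_1D by fastforce
  qed
  moreover have "theta (u * u) \<noteq> 0"
    using assms by (intro theta_nonzero) (simp add: power2_eq_square)
  ultimately show ?thesis
    using assms by (simp add: K_def)
qed

lemma pair_theta_simple_zero:
  assumes "u \<noteq> 0" "u\<^sup>2 \<notin> p_powers" "z \<noteq> 0" "pair_theta u z = 0"
  shows "deriv (pair_theta u) z \<noteq> 0"
proof -
  define e where "e = pair_theta u"
  have e: "e \<in> H1"
    using assms by (simp add: e_def pair_theta_in_H1)
  obtain q where q: "q \<in> p_powers" "z = q * u \<or> z = inverse (q * u)"
    using pair_theta_zero_cases assms by blast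
  have "(e (q * u) = 0 \<and> deriv e (q * u) \<noteq> 0) \<longleftrightarrow> (e u = 0 \<and> deriv e u \<noteq> 0)"
  proof (rule p_orbit_invariant)
    fix w :: complex assume "w \<noteq> 0"
    then show "(e (p * w) = 0 \<and> deriv e (p * w) \<noteq> 0) \<longleftrightarrow> (e w = 0 \<and> deriv e w \<noteq> 0)"
      using e by (cases "e w = 0") (auto simp: H1_shift H1_deriv_shift)
  qed (use assms q in auto)
  then have "deriv e (q * u) \<noteq> 0"
    using deriv_pair_theta_self pair_theta_self assms by (simp add: e_def)
  then show ?thesis
    using q H1_deriv_inverse[OF e, of "q * u"] assms p_powers_nonzero[of q]
    by (auto simp: e_def)
qed

text \<open>
  Multiplying by a power of \<open>p\<close> moves any \<open>z \<noteq> 0\<close> into the compact annulus \<open>\<bar>p\<bar> \<le> \<bar>z\<bar> \<le> 1\<close>, so \<open>h\<close> is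
  bounded, and Liouville's theorem applies to the entire function \<open>h \<circ> exp\<close>.
\<close>

lemma p_periodic_imp_constant:
  assumes hol: "h holomorphic_on - {0}" and per: "\<And>z. z \<noteq> 0 \<Longrightarrow> h (p * z) = h z"
  obtains c where "\<And>z. z \<noteq> 0 \<Longrightarrow> h z = c"
proof -
  define A where "A = cball (0::complex) 1 - ball 0 (norm p)"
  have "compact A"
    unfolding A_def by (intro compact_diff) auto
  moreover have "A \<subseteq> - {0}"
    using p_pos by (auto simp: A_def)
  ultimately have "compact (h ` A)"
    using hol by (meson compact_continuous_image holomorphic_on_imp_continuous_on
        holomorphic_on_subset)
  then obtain B where B: "\<And>z. z \<in> A \<Longrightarrow> norm (h z) \<le> B"
    using compact_imp_bounded[of "h ` A"] by (auto simp: bounded_iff)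
  have bound: "norm (h z) \<le> B" if z: "z \<noteq> 0" for z
  proof -
    define L where "L = - ln (norm p)"
    have L: "L > 0"
      using p_pos p_less by (simp add: L_def)
    \<comment> \<open>The least \<open>k\<close> with \<open>\<bar>p\<^sup>k z\<bar> \<le> 1\<close>.\<close>
    define k where "k = \<lceil>ln (norm z) / L\<rceil>"
    have "ln (norm z) / L \<le> k" "k \<le> ln (norm z) / L + 1"
      unfolding k_def by linarith+
    then have k: "ln (norm z) \<le> k * L" "k * L \<le> ln (norm z) + L"
      using L by (simp_all add: field_simps)
    have "norm (p powi k * z) = exp (- (k * L) + ln (norm z))"
      using p_pos z
      by (simp add: norm_mult norm_power_int exp_add L_def powr_real_of_int'[symmetric] powr_def)
    moreover have "exp (- (k * L) + ln (norm z)) \<le> exp 0" "exp (- L) \<le> exp (- (k * L) + ln (norm z))"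
      using k by (simp_all only: exp_le_cancel_iff)
    moreover have "exp (- L) = norm p"
      using p_pos by (simp add: L_def)
    ultimately have "p powi k * z \<in> A"
      by (simp add: A_def)
    moreover have "h (p powi k * z) = h z"
      using p_orbit_invariant[where Q = "\<lambda>w. h w = h z" and q = "p powi k" and z = z] per z
      by simp
    ultimately show ?thesis
      using B by metis
  qed
  have "(h \<circ> exp) holomorphic_on UNIV"
    by (rule holomorphic_on_compose_gen[OF holomorphic_on_exp hol]) auto
  then have "(\<lambda>w. h (exp w)) holomorphic_on UNIV"
    by (simp add: o_def)
  moreover have "bounded (range (\<lambda>w. h (exp w)))"
    unfolding bounded_iff using bound[OF exp_not_eq_zero] by blast
  ultimately have "(\<lambda>w. h (exp w)) constant_on UNIV"
    by (rule Liouville_theorem)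
  then obtain c where c: "\<And>w. h (exp w) = c"
    by (auto simp: constant_on_def)
  have "h z = c" if "z \<noteq> 0" for z
    using c[of "Ln z"] that by simp
  then show ?thesis by (rule that)
qed

text \<open>
  The condition on \<open>u\<^sup>2\<close> makes the zeros of \<open>pair_theta u\<close> simple, and \<open>g\<close> vanishes at all of them, so
  \<open>g / pair_theta u\<close> extends to a holomorphic function on \<open>\<complex>\<^sup>*\<close>, which is \<open>p\<close>-periodic.
\<close>

lemma H1_zero_imp_proportional:
  assumes g: "g \<in> H1" and "g u = 0" "u \<noteq> 0" "u\<^sup>2 \<notin> p_powers"
  obtains c where "\<And>z. z \<noteq> 0 \<Longrightarrow> g z = c * pair_theta u z"
proof -
  define e where "e = pair_theta u"
  have e: "e \<in> H1"
    using assms by (simp add: e_def pair_theta_in_H1)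
  define h where "h = (\<lambda>z. if e z = 0 then deriv g z / deriv e z else g z / e z)"
  have zeros: "g z = 0 \<and> deriv e z \<noteq> 0" if "z \<noteq> 0" "e z = 0" for z
    using assms that H1_zero_of_pair_theta pair_theta_simple_zero by (auto simp: e_def)
  have "h holomorphic_on - {0}"
    unfolding h_def
    by (rule holomorphic_quotient_simple_zeros) (use g e zeros in \<open>auto intro: H1_holomorphic\<close>)
  moreover have "h (p * z) = h z" if "z \<noteq> 0" for z
    using that zeros[of z] g e by (auto simp: h_def H1_shift H1_deriv_shift)
  ultimately obtain c where c: "\<And>z. z \<noteq> 0 \<Longrightarrow> h z = c"
    using p_periodic_imp_constant by blast
  have "g z = c * e z" if "z \<noteq> 0" for z
    using c[OF that] zeros[OF that] by (auto simp: h_def field_simps split: if_splits)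
  then show ?thesis
    using that unfolding e_def by blast
qed

text \<open>
  The generators are \<open>pair_theta 1\<close> and \<open>pair_theta u\<close> with \<open>u\<^sup>4 = p\<close>: such a \<open>u\<close> satisfies
  \<open>u\<^sup>2 \<notin> p\<^sup>\<int>\<close>, since otherwise \<open>p\<close> would be an even power of itself. Subtracting from \<open>g\<close> a multiple of
  \<open>pair_theta 1\<close>, which is nonzero at \<open>u\<close>, produces a zero at \<open>u\<close>.
\<close>

lemma H1_two_generators:
  obtains f1 f2 where "\<And>g. g \<in> H1 \<Longrightarrow> \<exists>a b. \<forall>z. z \<noteq> 0 \<longrightarrow> g z = a * f1 z + b * f2 z"
proof -
  define u where "u = csqrt (csqrt p)"
  have u4: "u ^ 4 = p"
    by (metis mult_2 numeral_Bit0 power2_csqrt power_mult u_def)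
  have u: "u \<noteq> 0"
    using u4 by auto
  have u2: "u\<^sup>2 \<notin> p_powers"
  proof
    assume "u\<^sup>2 \<in> p_powers"
    then obtain k :: int where k: "u\<^sup>2 = p powi k"
      by (auto simp: p_powers_def)
    have "p = (u\<^sup>2)\<^sup>2"
      using u4 by (simp flip: power_mult)
    also have "\<dots> = (p powi k)\<^sup>2"
      by (simp only: k)
    also have "\<dots> = p powi (2 * k)"
      by (simp only: power2_eq_square mult_2 power_int_add[OF disjI1[OF p_nonzero]])
    finally have "p powi (2 * k - 1) = 1"
      by (simp add: power_int_diff)
    then have "2 * k - 1 = 0"
      by (rule p_powi_eq_1D)
    then show False by presburger
  qed
  have u1: "u \<notin> p_powers"
    using u2 p_powers_mult[of u u] by (auto simp: power2_eq_square)
  have e1u: "pair_theta 1 u \<noteq> 0"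
    using u1 p_powers_inverse_iff[of u] by (intro pair_theta_nonzero) (auto simp: field_simps)
  have "\<exists>a b. \<forall>z. z \<noteq> 0 \<longrightarrow> g z = a * pair_theta 1 z + b * pair_theta u z" if g: "g \<in> H1" for g
  proof -
    define a where "a = g u / pair_theta 1 u"
    define g' where "g' = (\<lambda>z. 1 * g z + (- a) * pair_theta 1 z)"
    have "g' \<in> H1"
      unfolding g'_def using g by (intro H1_lincomb pair_theta_in_H1) auto
    moreover have "g' u = 0"
      using e1u by (simp add: g'_def a_def)
    ultimately obtain b where "\<And>z. z \<noteq> 0 \<Longrightarrow> g' z = b * pair_theta u z"
      using H1_zero_imp_proportional u u2 by blast
    then have "\<forall>z. z \<noteq> 0 \<longrightarrow> g z = a * pair_theta 1 z + b * pair_theta u z"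
      by (simp add: g'_def algebra_simps)
    then show ?thesis by blast
  qed
  then show ?thesis by (rule that)
qed

text \<open>
  The functions \<open>pair_theta x\<close> and \<open>pair_theta y\<close> vanish at one of the two points and not at the other.
  Hence evaluation at \<open>x\<close> and \<open>y\<close> is an isomorphism of the two-dimensional space \<open>H1\<close> onto \<open>\<complex>\<^sup>2\<close>; the
  determinant \<open>D\<close> below is that of this evaluation in terms of the two generators. The detour
  through generators covers the points \<open>x\<close> with \<open>x\<^sup>2 \<in> p\<^sup>\<int>\<close>, where \<open>pair_theta x\<close> has double
  zeros.
\<close>

lemma H1_two_zeros_imp_zero:
  assumes g: "g \<in> H1" "g x = 0" "g y = 0"
    and xy: "x \<noteq> 0" "y \<noteq> 0" "x * y \<notin> p_powers" "x / y \<notin> p_powers" and z: "z \<noteq> 0"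
  shows "g z = 0"
proof -
  obtain f1 f2 where gen: "\<And>g. g \<in> H1 \<Longrightarrow> \<exists>a b. \<forall>z. z \<noteq> 0 \<longrightarrow> g z = a * f1 z + b * f2 z"
    using H1_two_generators by blast
  have ex: "pair_theta x x = 0" "pair_theta x y \<noteq> 0"
    using xy by (auto simp: pair_theta_self pair_theta_nonzero)
  have "y / x \<notin> p_powers"
    using xy p_powers_inverse_iff[of "x / y"] by simp
  then have ey: "pair_theta y y = 0" "pair_theta y x \<noteq> 0"
    using xy by (auto simp: pair_theta_self pair_theta_nonzero mult.commute)
  obtain a b where ab: "\<And>z. z \<noteq> 0 \<Longrightarrow> pair_theta x z = a * f1 z + b * f2 z"
    using gen[OF pair_theta_in_H1] xy by blast
  obtain c d where cd: "\<And>z. z \<noteq> 0 \<Longrightarrow> pair_theta y z = c * f1 z + d * f2 z"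
    using gen[OF pair_theta_in_H1] xy by blast
  obtain \<alpha> \<beta> where g_eq: "\<And>z. z \<noteq> 0 \<Longrightarrow> g z = \<alpha> * f1 z + \<beta> * f2 z"
    using gen[OF g(1)] by blast
  define D where "D = f1 x * f2 y - f1 y * f2 x"
  have "(a * d - b * c) * D = pair_theta x x * pair_theta y y - pair_theta x y * pair_theta y x"
    unfolding D_def ab[OF xy(1)] ab[OF xy(2)] cd[OF xy(1)] cd[OF xy(2)] by (simp add: algebra_simps)
  then have "D \<noteq> 0"
    using ex ey by auto
  moreover have "\<alpha> * D = g x * f2 y - g y * f2 x" "\<beta> * D = g y * f1 x - g x * f1 y"
    unfolding D_def g_eq[OF xy(1)] g_eq[OF xy(2)] by (simp_all add: algebra_simps)
  ultimately show ?thesis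
    using g g_eq[OF z] by simp
qed

end

section \<open>Evaluation at the reference points is injective\<close>

definition coords :: "complex ^ 'n \<Rightarrow> complex multiset" where
  "coords z = image_mset (\<lambda>i. z $ i) (mset_set (UNIV :: 'n::finite set))"

lemma size_coords [simp]: "size (coords (z :: complex ^ 'n)) = CARD('n::finite)"
  by (simp add: coords_def)

lemma permuted_coordinates:
  fixes z w :: "complex ^ 'n::finite"
  assumes "coords z = coords w"
  obtains \<sigma> where "\<sigma> permutes (UNIV :: 'n set)" "z = W_act (\<lambda>_. False) \<sigma> w"
proof -
  obtain \<sigma> where "\<sigma> permutes (UNIV :: 'n set)" "\<forall>i\<in>UNIV. z $ i = w $ \<sigma> i"
    using image_mset_eq_implies_permutes[OF finite assms[unfolded coords_def]] by metis
  then show ?thesis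
    by (intro that) (auto simp: W_act_def vec_eq_iff)
qed

definition set_coord :: "complex ^ 'n \<Rightarrow> 'n \<Rightarrow> complex \<Rightarrow> complex ^ 'n::finite" where
  "set_coord z i w = (\<chi> j. if j = i then w else z $ j)"

lemma set_coord_self [simp]: "set_coord z i (z $ i) = z"
  by (simp add: set_coord_def vec_eq_iff)

lemma set_coord_in_torus: "z \<in> torus \<Longrightarrow> w \<noteq> 0 \<Longrightarrow> set_coord z i w \<in> torus"
  by (simp add: set_coord_def torus_def)

text \<open>
  Stated additively, to avoid the subtraction of multisets.
\<close>

lemma coords_set_coord:
  "add_mset (z $ i) (coords (set_coord z i w)) = add_mset w (coords (z :: complex ^ 'n::finite))"
proof -
  have "mset_set (UNIV :: 'n set) = add_mset i (mset_set (UNIV - {i}))"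
    by (metis UNIV_I finite mset_set.remove)
  moreover have "image_mset (\<lambda>j. set_coord z i w $ j) (mset_set (UNIV - {i}))
      = image_mset (\<lambda>j. z $ j) (mset_set (UNIV - {i}))"
    by (intro image_mset_cong) (auto simp: set_coord_def)
  ultimately show ?thesis
    by (simp add: coords_def set_coord_def)
qed

text \<open>
  A complex-linear Frechet derivative restricts to a complex derivative along each coordinate axis.
\<close>

lemma holomorphic_multi_on_slice:
  fixes f :: "complex ^ 'n::finite \<Rightarrow> complex"
  assumes f: "holomorphic_multi_on f torus" and z: "z \<in> torus"
  shows "(\<lambda>w. f (set_coord z i w)) holomorphic_on - {0}"
proof (rule holomorphic_onI)
  fix w :: complex assume "w \<in> - {0}"
  then have "set_coord z i w \<in> torus"
    using z by (simp add: set_coord_in_torus)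
  then obtain D where D: "(f has_derivative D) (at (set_coord z i w))" "\<And>c v. D (c *s v) = c * D v"
    using f by (auto simp: holomorphic_multi_on_def)
  have coord: "set_coord z i x = set_coord z i 0 + axis i x" for x
    by (simp add: set_coord_def axis_def vec_eq_iff)
  have axis: "axis i x = x *s axis i (1 :: complex)" for x
    by (simp add: axis_def vec_eq_iff)
  have "linear (axis i :: complex \<Rightarrow> complex ^ 'n)"
    by (auto intro!: linearI simp: axis_def vec_eq_iff)
  then have "((\<lambda>x. set_coord z i 0 + axis i x) has_derivative axis i) (at w)"
    by (auto intro!: derivative_eq_intros linear_imp_has_derivative)
  then have "(set_coord z i has_derivative axis i) (at w)"
    by (simp only: coord[symmetric])
  then have "((\<lambda>w. f (set_coord z i w)) has_derivative (\<lambda>x. D (axis i x))) (at w)"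
    using has_derivative_compose D(1) by blast
  moreover have "(\<lambda>x. D (axis i x)) = (*) (D (axis i 1))"
  proof
    fix x
    show "D (axis i x) = D (axis i 1) * x"
      by (subst axis[of x]) (simp only: D(2) mult.commute)
  qed
  ultimately have "((\<lambda>w. f (set_coord z i w)) has_field_derivative D (axis i 1)) (at w)"
    unfolding has_field_derivative_def by metis
  then show "(\<lambda>w. f (set_coord z i w)) field_differentiable at w within - {0}"
    using field_differentiable_at_within field_differentiable_def by blast
qed

lemma index_pos_bij: "bij_betw index_pos (UNIV :: 'n::{finite,linorder} set) {..<CARD('n)}"
proof -
  have less: "index_pos i < index_pos j" if "i < j" for i j :: 'n
    unfolding index_pos_def using that by (intro psubset_card_mono) auto
  have "inj (index_pos :: 'n \<Rightarrow> nat)"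
    by (rule injI) (metis less less_irrefl neqE)
  moreover have "index_pos i < CARD('n)" for i :: 'n
    unfolding index_pos_def by (intro psubset_card_mono) auto
  ultimately show ?thesis
    unfolding bij_betw_def by (intro conjI card_subset_eq) (auto simp: card_image)
qed

text \<open>
  The partial matches of the induction: the first \<open>i\<close> terms of the progression starting at \<open>a1\<close> and the
  first \<open>j\<close> terms of the one starting at \<open>a2\<close>. Multisets are needed because terms may coincide, for
  instance when \<open>t\<close> is a root of unity.
\<close>

definition progressions :: "complex \<Rightarrow> complex \<Rightarrow> complex \<Rightarrow> nat \<Rightarrow> nat \<Rightarrow> complex multiset" where
  "progressions a1 a2 t i j =
     image_mset (\<lambda>k. a1 * t ^ k) (mset_set {..<i}) + image_mset (\<lambda>k. a2 * t ^ k) (mset_set {..<j})"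

lemma size_progressions [simp]: "size (progressions a1 a2 t i j) = i + j"
  by (simp add: progressions_def)

lemma progressions_Suc:
  "progressions a1 a2 t (Suc i) j = add_mset (a1 * t ^ i) (progressions a1 a2 t i j)"
  "progressions a1 a2 t i (Suc j) = add_mset (a2 * t ^ j) (progressions a1 a2 t i j)"
  by (simp_all add: progressions_def lessThan_Suc)

lemma coords_ref_point:
  fixes a1 a2 t :: complex
  assumes "s \<le> CARD('n::{finite,linorder})"
  shows "coords (ref_point a1 a2 t s :: complex ^ 'n::{finite,linorder})
           = progressions a1 a2 t s (CARD('n) - s)"
proof -
  define h where "h = (\<lambda>k. if k < s then a1 * t ^ k else a2 * t ^ (k - s))"
  have "coords (ref_point a1 a2 t s :: (complex, 'n) vec)
      = image_mset h (image_mset index_pos (mset_set (UNIV :: 'n set)))"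
    by (simp add: coords_def ref_point_def h_def Let_def multiset.map_comp o_def)
  also have "image_mset index_pos (mset_set (UNIV :: 'n set)) = mset_set {..<CARD('n)}"
    using index_pos_bij by (metis bij_betw_def image_mset_mset_set)
  also have "{..<CARD('n)} = {..<s} \<union> (\<lambda>k. k + s) ` {..<CARD('n) - s}"
  proof (safe, goal_cases)
    case (1 k)
    then show ?case by (metis diff_less_mono image_eqI le_add_diff_inverse2 lessThan_iff not_le)
  qed (use assms in auto)
  also have "mset_set \<dots> = mset_set {..<s} + image_mset (\<lambda>k. k + s) (mset_set {..<CARD('n) - s})"
    by (subst mset_set_Union) (auto simp: image_mset_mset_set inj_on_def)
  also have "image_mset h \<dots> = progressions a1 a2 t s (CARD('n) - s)"
    unfolding progressions_def
    by (auto simp: h_def multiset.map_comp o_def intro!: arg_cong2[where f = "(+)"] image_mset_cong)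
  finally show ?thesis .
qed

context nome
begin

lemma H_space_slice_in_H1:
  assumes f: "f \<in> H_space p" and z: "z \<in> torus"
  shows "(\<lambda>w. f (set_coord z i w)) \<in> H1"
proof -
  have "f (set_coord z i (inverse w)) = f (set_coord z i w)" if "w \<noteq> 0" for w
  proof -
    have "W_act (\<lambda>j. j = i) id (set_coord z i w) = set_coord z i (inverse w)"
      by (simp add: W_act_def set_coord_def vec_eq_iff)
    moreover have "f (W_act (\<lambda>j. j = i) id (set_coord z i w)) = f (set_coord z i w)"
      using f z that permutes_id by (auto simp: H_space_def W_invariant_def set_coord_in_torus)
    ultimately show ?thesis by simp
  qed
  moreover have "f (set_coord z i (p * w)) = f (set_coord z i w) / (p * w\<^sup>2)" if "w \<noteq> 0" for w
  proof -
    have "shift_op p i f (set_coord z i w) = f (set_coord z i (p * w))"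
      unfolding shift_op_def set_coord_def by (intro arg_cong[of _ _ f]) (simp add: vec_eq_iff)
    moreover have "shift_op p i f (set_coord z i w) = f (set_coord z i w) / (p * (set_coord z i w $ i)\<^sup>2)"
      using f set_coord_in_torus[OF z that] by (auto simp: H_space_def)
    ultimately show ?thesis
      by (simp add: set_coord_def)
  qed
  moreover have "(\<lambda>w. f (set_coord z i w)) holomorphic_on - {0}"
    using f z by (intro holomorphic_multi_on_slice) (auto simp: H_space_def hol_torus_def)
  ultimately show ?thesis
    by (simp add: H1_def)
qed

lemma generic_params_independent:
  assumes gen: "generic_params n p t a1 a2" and "a1 \<noteq> 0" "a2 \<noteq> 0" "t \<noteq> 0" "i + j < n"
  shows "(a1 * t ^ i) * (a2 * t ^ j) \<notin> p_powers" "(a1 * t ^ i) / (a2 * t ^ j) \<notin> p_powers"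
proof -
  have products: "\<forall>m. m \<le> n - 1 \<longrightarrow> a1 * a2 * t ^ m \<notin> p_powers"
    and quotients: "\<forall>m::int. \<bar>m\<bar> \<le> int n - 1 \<longrightarrow> a1 * inverse a2 * t powi m \<notin> p_powers"
    using gen unfolding generic_params_def p_powers_def by argo+
  have "a1 * a2 * t ^ (i + j) \<notin> p_powers"
    using \<open>i + j < n\<close> by (intro products[rule_format]) linarith
  then show "(a1 * t ^ i) * (a2 * t ^ j) \<notin> p_powers"
    by (simp add: power_add mult_ac)
  have "a1 * inverse a2 * t powi (int i - int j) \<notin> p_powers"
    using \<open>i + j < n\<close> by (intro quotients[rule_format]) linarith
  then show "(a1 * t ^ i) / (a2 * t ^ j) \<notin> p_powers"
    using assms by (simp add: power_int_diff field_simps)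
qed

text \<open>
  Downward induction on the number \<open>i + j\<close> of prescribed coordinates; in each step one free coordinate
  is treated by the vanishing theorem for \<open>H1\<close>.
\<close>

proposition H_space_zero_if_zero_at_ref_points:
  fixes f :: "complex ^ 'n::{finite,linorder} \<Rightarrow> complex"
  assumes f: "f \<in> H_space p" and nz: "a1 \<noteq> 0" "a2 \<noteq> 0" "t \<noteq> 0"
    and gen: "generic_params CARD('n) p t a1 a2"
    and zero: "\<And>s. s \<le> CARD('n) \<Longrightarrow> f (ref_point a1 a2 t s) = 0"
  shows "f = 0"
proof -
  have "f z = 0"
    if "i + j \<le> CARD('n)" "z \<in> torus" "progressions a1 a2 t i j \<subseteq># coords z"
    for i j z
    using that
  proof (induction "CARD('n) - (i + j)" arbitrary: i j z)
    case 0
    then have ij: "j = CARD('n) - i" "i \<le> CARD('n)"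
      by auto
    have "progressions a1 a2 t i j = coords z"
      using 0 by (metis mset_subset_size subset_mset.le_imp_less_or_eq diff_is_0_eq leD
          size_coords size_progressions)
    then have "coords z
        = coords (ref_point a1 a2 t i :: (complex, 'n) vec)"
      using coords_ref_point[where 'n = 'n, of i] ij by simp
    then obtain \<sigma> where "\<sigma> permutes UNIV" "z = W_act (\<lambda>_. False) \<sigma> (ref_point a1 a2 t i)"
      by (rule permuted_coordinates)
    moreover have "(ref_point a1 a2 t i :: (complex, 'n) vec) \<in> torus"
      using nz by (simp add: torus_def ref_point_def Let_def)
    ultimately show ?case
      using f zero ij by (simp add: H_space_def W_invariant_def)
  next
    case (Suc k)
    let ?X = "progressions a1 a2 t i j"
    have lt: "i + j < CARD('n)"
      using Suc by linarith
    have "?X \<noteq> coords z"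
      using lt by (metis less_irrefl size_coords size_progressions)
    \<comment> \<open>The coordinate \<open>l\<close> is one that the match \<open>?X\<close> leaves free.\<close>
    then obtain R where R: "coords z = ?X + R" "R \<noteq> {#}"
      using Suc.prems(3) by (metis mset_subset_eq_exists_conv add_0_right)
    then obtain r R' where R': "R = add_mset r R'"
      by (metis multiset_cases)
    have "r \<in># coords z"
      by (simp add: R R')
    then obtain l where l: "z $ l = r"
      by (auto simp: coords_def)
    have coords: "coords (set_coord z l w) = add_mset w (?X + R')" for w
      using coords_set_coord[of z l w] by (simp add: R R' l add_mset_commute)
    have "f (set_coord z l (a1 * t ^ i)) = 0"
      using Suc.prems nz lt Suc.hyps(2)
      by (intro Suc.hyps(1)[of "Suc i" j]) (auto simp: coords progressions_Suc set_coord_in_torus)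
    moreover have "f (set_coord z l (a2 * t ^ j)) = 0"
      using Suc.prems nz lt Suc.hyps(2)
      by (intro Suc.hyps(1)[of i "Suc j"]) (auto simp: coords progressions_Suc set_coord_in_torus)
    moreover have "z $ l \<noteq> 0"
      using Suc.prems by (simp add: torus_def)
    ultimately have "f (set_coord z l (z $ l)) = 0"
      using H1_two_zeros_imp_zero[OF H_space_slice_in_H1[OF f Suc.prems(2)], of l "a1 * t ^ i" "a2 * t ^ j" "z $ l"]
        generic_params_independent[OF gen nz lt] nz by simp
    then show ?case by simp
  qed
  from this[of 0 0] have "f z = 0" if "z \<in> torus" for z
    using that by (simp add: progressions_def)
  moreover have "f z = 0" if "z \<notin> torus" for z
    using f that by (simp add: H_space_def hol_torus_def)
  ultimately show ?thesis
    by (metis ext zero_fun_apply)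
qed

end

section \<open>Interpolation at the reference points\<close>

lemma fun_sum_apply: "sum f A x = (\<Sum>i\<in>A. f i x)"
  for f :: "'i \<Rightarrow> 'a \<Rightarrow> 'b::comm_monoid_add"
  by (induction A rule: infinite_finite_induct) auto

text \<open>
  Injectivity makes the \<open>n + 1\<close> rows of \<open>A\<close> independent in a space spanned by \<open>n + 1\<close> unit vectors, so
  no further vector can be independent of them. The rows are regarded as sequences supported on
  \<open>{0..n}\<close>.
\<close>

lemma injective_square_system_solvable:
  fixes A :: "nat \<Rightarrow> nat \<Rightarrow> complex"
  assumes inj: "\<And>c. (\<And>s. s \<le> n \<Longrightarrow> (\<Sum>m\<le>n. c m * A m s) = 0) \<Longrightarrow> \<forall>m\<le>n. c m = 0"
  obtains c where "\<And>s. s \<le> n \<Longrightarrow> (\<Sum>m\<le>n. c m * A m s) = b s"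
proof -
  define v where "v = (\<lambda>m s. if s \<le> n then A m s else 0)"
  define D where "D = (\<lambda>k s::nat. if s = k then 1 else 0 :: complex)"
  have v0: "\<forall>m\<le>n. c m = 0" if "(\<Sum>m\<le>n. cscale (c m) (v m)) = 0" for c
  proof (rule inj)
    fix s assume "s \<le> n"
    then show "(\<Sum>m\<le>n. c m * A m s) = 0"
      using fun_cong[OF that, of s] by (simp add: fun_sum_apply cscale_def v_def)
  qed
  have inj_v: "inj_on v {..n}"
  proof (rule inj_onI, rule ccontr)
    fix m m' assume m: "m \<in> {..n}" "m' \<in> {..n}" "v m = v m'" "m \<noteq> m'"
    \<comment> \<open>Equal rows would give the nontrivial relation \<open>v m - v m' = 0\<close>.\<close>
    have "(\<Sum>k\<le>n. cscale ((if k = m then 1 else 0) - (if k = m' then 1 else 0)) (v k)) = 0"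
    proof
      fix s
      show "(\<Sum>k\<le>n. cscale ((if k = m then 1 else 0) - (if k = m' then 1 else 0)) (v k)) s = 0 s"
        using m by (simp add: fun_sum_apply cscale_def left_diff_distrib sum_subtractf if_distrib
            [of "\<lambda>c. c * _"] cong: if_cong)
    qed
    from v0[OF this] m show False by auto
  qed
  have indep: "cfun.independent (v ` {..n})"
  proof (rule cfun.independent_if_scalars_zero)
    fix f x assume "(\<Sum>x\<in>v ` {..n}. cscale (f x) x) = 0" "x \<in> v ` {..n}"
    then show "f x = 0"
      using v0[of "f \<circ> v"] by (auto simp: sum.reindex[OF inj_v])
  qed auto
  have in_span: "w \<in> cfun.span (D ` {..n})" if "\<And>s. s > n \<Longrightarrow> w s = 0" for w
  proof -
    have "w = (\<Sum>k\<le>n. cscale (w k) (D k))"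
    proof
      fix s
      show "w s = (\<Sum>k\<le>n. cscale (w k) (D k)) s"
        using that[of s] by (cases "s \<le> n")
          (simp_all add: fun_sum_apply cscale_def D_def if_distrib[of "\<lambda>x. _ * x"] cong: if_cong)
    qed
    also have "\<dots> \<in> cfun.span (D ` {..n})"
      by (intro cfun.span_sum cfun.span_scale cfun.span_base) auto
    finally show ?thesis .
  qed
  define b' where "b' = (\<lambda>s. if s \<le> n then b s else 0)"
  have "b' \<in> cfun.span (v ` {..n})"
  proof (rule ccontr)
    assume b': "b' \<notin> cfun.span (v ` {..n})"
    then have "cfun.independent (insert b' (v ` {..n}))"
      using indep by (rule cfun.independent_insertI)
    moreover have "insert b' (v ` {..n}) \<subseteq> cfun.span (D ` {..n})"
      by (auto simp: b'_def v_def intro!: in_span)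
    ultimately have "card (insert b' (v ` {..n})) \<le> card (D ` {..n})"
      using cfun.independent_span_bound[of "D ` {..n}"] by blast
    also have "\<dots> \<le> n + 1"
      using card_image_le[of "{..n}" D] by simp
    finally show False
      using b' cfun.span_base[of b' "v ` {..n}"]
      by (subst (asm) card_insert_disjoint) (auto simp: card_image[OF inj_v])
  qed
  then obtain u where "b' = (\<Sum>x\<in>v ` {..n}. cscale (u x) x)"
    by (auto simp: cfun.span_finite)
  then have b': "b' = (\<Sum>m\<le>n. cscale (u (v m)) (v m))"
    by (simp add: sum.reindex[OF inj_v])
  have "(\<Sum>m\<le>n. u (v m) * A m s) = b s" if "s \<le> n" for s
  proof -
    have "b' s = (\<Sum>m\<le>n. u (v m) * v m s)"
      by (subst b') (simp only: fun_sum_apply cscale_def)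
    then show ?thesis
      using that by (simp add: b'_def v_def)
  qed
  then show ?thesis by (rule that)
qed

text \<open>
  By linearity the hypothesis says \<open>\<Sum>\<^sub>k c\<^sub>k q(k) = 0\<close> for every polynomial \<open>q\<close> of degree at most \<open>n\<close>;
  the Lagrange polynomial vanishing at all nodes but \<open>m\<close> isolates \<open>c\<^sub>m\<close>.
\<close>

lemma vandermonde_independent:
  fixes c :: "nat \<Rightarrow> complex"
  assumes zero: "\<And>s. s \<le> n \<Longrightarrow> (\<Sum>m\<le>n. c m * of_nat m ^ s) = 0" and "m \<le> n"
  shows "c m = 0"
proof -
  define q where "q = (\<Prod>l\<in>{..n} - {m}. [:- of_nat l, 1 :: complex:])"
  have "degree q = (\<Sum>l\<in>{..n} - {m}. 1)"
    unfolding q_def by (subst degree_prod_sum_eq) auto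
  then have deg: "degree q \<le> n"
    using \<open>m \<le> n\<close> by simp
  have "(\<Sum>k\<le>n. c k * poly q (of_nat k)) = (\<Sum>k\<le>n. \<Sum>s\<le>degree q. coeff q s * (c k * of_nat k ^ s))"
    by (simp add: poly_altdef sum_distrib_left mult_ac)
  also have "\<dots> = (\<Sum>s\<le>degree q. coeff q s * (\<Sum>k\<le>n. c k * of_nat k ^ s))"
    by (subst sum.swap) (simp add: sum_distrib_left)
  also have "\<dots> = 0"
    using zero deg by simp
  finally have "(\<Sum>k\<le>n. c k * poly q (of_nat k)) = 0" .
  moreover have "poly q (of_nat k) = 0" if "k \<le> n" "k \<noteq> m" for k
    using that by (auto simp: q_def poly_prod)
  then have "(\<Sum>k\<le>n. c k * poly q (of_nat k)) = (\<Sum>k\<in>{m}. c k * poly q (of_nat k))"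
    using \<open>m \<le> n\<close> by (intro sum.mono_neutral_right) auto
  moreover have "poly q (of_nat m) \<noteq> 0"
    by (auto simp: q_def poly_prod)
  ultimately show ?thesis by simp
qed

lemma holomorphic_multi_on_prod_coords:
  fixes g :: "complex \<Rightarrow> complex" and I :: "'n::finite set"
  assumes g: "g holomorphic_on - {0}"
  shows "holomorphic_multi_on (\<lambda>z :: complex ^ 'n. \<Prod>i\<in>I. g (z $ i)) torus"
  unfolding holomorphic_multi_on_def
proof
  fix z :: "complex ^ 'n" assume z: "z \<in> torus"
  define D where "D = (\<lambda>v :: complex ^ 'n.
    \<Sum>i\<in>I. deriv g (z $ i) * v $ i * (\<Prod>j\<in>I - {i}. g (z $ j)))"
  have "((\<lambda>z. g (z $ i)) has_derivative (\<lambda>v. deriv g (z $ i) * v $ i)) (at z)" for i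
  proof -
    have coord: "((\<lambda>z. z $ i) has_derivative (\<lambda>v. v $ i)) (at z)"
      by (rule bounded_linear_imp_has_derivative) (rule bounded_linear_vec_nth)
    have "(g has_field_derivative deriv g (z $ i)) (at (z $ i))"
      using z by (intro holomorphic_derivI[OF g]) (auto simp: torus_def)
    then have "(g has_derivative (\<lambda>v. deriv g (z $ i) * v)) (at (z $ i))"
      by (simp add: has_field_derivative_def)
    with coord show ?thesis
      by (rule has_derivative_compose)
  qed
  then have "((\<lambda>z. \<Prod>i\<in>I. g (z $ i)) has_derivative D) (at z)"
    unfolding D_def by (rule has_derivative_prod)
  moreover have "\<forall>c v. D (c *s v) = c * D v"
    by (simp add: D_def sum_distrib_left mult_ac)
  ultimately show "\<exists>D. ((\<lambda>z. \<Prod>i\<in>I. g (z $ i)) has_derivative D) (at z) \<and> (\<forall>c v. D (c *s v) = c * D v)"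
    by blast
qed

lemma open_torus: "open (torus :: (complex ^ 'n::finite) set)"
proof -
  have "torus = (\<Inter>i. {z :: complex ^ 'n. z $ i \<noteq> 0})"
    by (auto simp: torus_def)
  also have "open \<dots>"
    by (intro open_INT ballI open_Collect_neq continuous_intros) auto
  finally show ?thesis .
qed

definition prod_fun :: "(complex \<Rightarrow> complex) \<Rightarrow> complex ^ 'n::finite \<Rightarrow> complex" where
  "prod_fun g z = (if z \<in> torus then \<Prod>i\<in>UNIV. g (z $ i) else 0)"

lemma prod_fun_in_hol_torus:
  assumes "g holomorphic_on - {0}"
  shows "(prod_fun g :: complex ^ 'n::finite \<Rightarrow> complex) \<in> hol_torus"
proof -
  have "holomorphic_multi_on (prod_fun g) (torus :: (complex ^ 'n) set)"
    unfolding holomorphic_multi_on_def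
  proof
    fix z :: "complex ^ 'n" assume z: "z \<in> torus"
    with holomorphic_multi_on_prod_coords[OF assms, of UNIV] obtain D
      where D: "((\<lambda>z. \<Prod>i\<in>UNIV. g (z $ i)) has_derivative D) (at z)" "\<forall>c v. D (c *s v) = c * D v"
      unfolding holomorphic_multi_on_def by blast
    have "(prod_fun g has_derivative D) (at z)"
      by (rule has_derivative_transform_within_open[OF D(1) open_torus z]) (simp add: prod_fun_def)
    with D(2) show "\<exists>D. (prod_fun g has_derivative D) (at z) \<and> (\<forall>c v. D (c *s v) = c * D v)"
      by blast
  qed
  then show ?thesis
    by (auto simp: hol_torus_def prod_fun_def)
qed

context nome
begin

lemma prod_fun_in_H_space:
  assumes g: "g \<in> H1"
  shows "(prod_fun g :: complex ^ 'n::finite \<Rightarrow> complex) \<in> H_space p"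
proof -
  have "prod_fun g (W_act \<epsilon> \<sigma> z) = prod_fun g z"
    if \<sigma>: "\<sigma> permutes UNIV" and z: "z \<in> torus" for \<epsilon> \<sigma> and z :: "complex ^ 'n"
  proof -
    have "g (W_act \<epsilon> \<sigma> z $ i) = g (z $ \<sigma> i)" for i
      using z g by (auto simp: W_act_def torus_def H1_inverse)
    moreover have "(\<Prod>i\<in>UNIV. g (z $ \<sigma> i)) = (\<Prod>i\<in>UNIV. g (z $ i))"
      using prod.permute[OF \<sigma>, of "\<lambda>i. g (z $ i)"] by (simp add: o_def)
    moreover have "W_act \<epsilon> \<sigma> z \<in> torus"
      using z by (simp add: W_act_def torus_def)
    ultimately show ?thesis
      using z by (simp add: prod_fun_def)
  qed
  moreover have "shift_op p i (prod_fun g) z = prod_fun g z / (p * (z $ i)\<^sup>2)"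
    if z: "z \<in> torus" for i and z :: "complex ^ 'n"
  proof -
    define z' where "z' = (\<chi> j. if j = i then p * z $ j else z $ j)"
    have "z' \<in> torus"
      using z by (simp add: z'_def torus_def)
    have "(\<Prod>j\<in>UNIV. g (z' $ j)) = g (z' $ i) * (\<Prod>j\<in>UNIV - {i}. g (z' $ j))"
      by (simp add: prod.remove[of UNIV i])
    also have "(\<Prod>j\<in>UNIV - {i}. g (z' $ j)) = (\<Prod>j\<in>UNIV - {i}. g (z $ j))"
      by (intro prod.cong) (auto simp: z'_def)
    also have "g (z' $ i) = g (z $ i) / (p * (z $ i)\<^sup>2)"
      using z g by (simp add: z'_def torus_def H1_shift)
    also have "\<dots> * (\<Prod>j\<in>UNIV - {i}. g (z $ j)) = (\<Prod>j\<in>UNIV. g (z $ j)) / (p * (z $ i)\<^sup>2)"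
      by (simp add: prod.remove[of UNIV i])
    finally show ?thesis
      using z \<open>z' \<in> torus\<close> by (simp add: shift_op_def prod_fun_def z'_def)
  qed
  ultimately show ?thesis
    using g prod_fun_in_hol_torus[OF H1_holomorphic[OF g]] by (auto simp: H_space_def W_invariant_def)
qed

text \<open>
  The natural numbers \<open>m\<close> serve as the distinct nodes of a Vandermonde matrix.
\<close>

definition pencil :: "complex \<Rightarrow> complex \<Rightarrow> nat \<Rightarrow> complex \<Rightarrow> complex" where
  "pencil a1 a2 m w = pair_theta a1 w + of_nat m * pair_theta a2 w"

lemma pencil_in_H1: "a1 \<noteq> 0 \<Longrightarrow> a2 \<noteq> 0 \<Longrightarrow> pencil a1 a2 m \<in> H1"
  using H1_lincomb[OF pair_theta_in_H1 pair_theta_in_H1, of a1 a2 1 "of_nat m"]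
  by (simp add: pencil_def[abs_def])

text \<open>
  If \<open>s\<close> coordinates of \<open>z\<close> equal \<open>a1\<close> and all others equal \<open>a2\<close>, then, because \<open>pair_theta a1\<close> and
  \<open>pair_theta a2\<close> vanish at \<open>a1\<close> and \<open>a2\<close> respectively, the product is \<open>m\<^sup>s\<close> times a nonzero constant \<open>K\<close>
  that does not depend on \<open>m\<close>.
\<close>

lemma prod_fun_pencil_independent:
  assumes nz: "a1 \<noteq> 0" "a2 \<noteq> 0" and a: "a1 * a2 \<notin> p_powers" "a1 / a2 \<notin> p_powers"
    and zero: "\<And>z :: complex ^ 'n::finite. z \<in> torus \<Longrightarrow>
      (\<Sum>m\<le>CARD('n). c m * prod_fun (pencil a1 a2 m) z) = 0"
    and m: "m \<le> CARD('n)"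
  shows "c m = 0"
proof -
  have "a2 / a1 \<notin> p_powers"
    using a p_powers_inverse_iff[of "a1 / a2"] by simp
  then have nz': "pair_theta a1 a2 \<noteq> 0" "pair_theta a2 a1 \<noteq> 0"
    using a pair_theta_nonzero[of a1 a2] pair_theta_nonzero[of a2 a1]
    by (simp_all add: mult.commute)
  have "(\<Sum>m\<le>CARD('n). c m * of_nat m ^ s) = 0" if s: "s \<le> CARD('n)" for s
  proof -
    obtain S :: "'n set" where S: "card S = s"
      using s obtain_subset_with_card_n[of s UNIV] by auto
    define z :: "complex ^ 'n" where "z = (\<chi> i. if i \<in> S then a1 else a2)"
    define K where "K = pair_theta a2 a1 ^ s * pair_theta a1 a2 ^ (CARD('n) - s)"
    have z: "z \<in> torus"
      using nz by (simp add: torus_def z_def)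
    have "prod_fun (pencil a1 a2 m) z = of_nat m ^ s * K" for m
    proof -
      have "prod_fun (pencil a1 a2 m) z
          = (\<Prod>i\<in>UNIV. if i \<in> S then of_nat m * pair_theta a2 a1 else pair_theta a1 a2)"
        using z nz by (auto simp: prod_fun_def pencil_def z_def pair_theta_self intro!: prod.cong)
      also have "\<dots> = (of_nat m * pair_theta a2 a1) ^ card S * pair_theta a1 a2 ^ card (- S)"
        by (subst prod.If_cases) auto
      finally show ?thesis
        by (simp add: K_def S Compl_eq_Diff_UNIV card_Diff_subset power_mult_distrib)
    qed
    then have "(\<Sum>m\<le>CARD('n). c m * of_nat m ^ s) * K
        = (\<Sum>m\<le>CARD('n). c m * prod_fun (pencil a1 a2 m) z)"
      by (simp add: sum_distrib_left mult_ac)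
    then have "(\<Sum>m\<le>CARD('n). c m * of_nat m ^ s) * K = 0"
      using zero[OF z] by simp
    moreover have "K \<noteq> 0"
      using nz' by (simp add: K_def)
    ultimately show ?thesis by simp
  qed
  then show ?thesis
    using vandermonde_independent m by blast
qed

text \<open>
  The matrix of values of the \<open>n + 1\<close> independent products at the \<open>n + 1\<close> reference points is
  invertible: a combination that vanishes at these points is zero.
\<close>

proposition H_space_interpolation:
  fixes b :: "nat \<Rightarrow> complex"
  assumes nz: "a1 \<noteq> 0" "a2 \<noteq> 0" "t \<noteq> 0"
    and gen: "generic_params CARD('n::{finite,linorder}) p t a1 a2"
  obtains f where "f \<in> H_space p"
    and "\<And>s. s \<le> CARD('n) \<Longrightarrow> f (ref_point a1 a2 t s :: (complex, 'n) vec) = b s"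
proof -
  define g where "g = (\<lambda>m. prod_fun (pencil a1 a2 m) :: (complex, 'n) vec \<Rightarrow> complex)"
  define F where "F = (\<lambda>c. \<Sum>m\<le>CARD('n). cscale (c m) (g m))"
  have F_apply: "F c z = (\<Sum>m\<le>CARD('n). c m * g m z)" for c z
    by (simp add: F_def fun_sum_apply cscale_def)
  have F: "F c \<in> H_space p" for c
    unfolding F_def g_def using nz subspace_H_space
    by (intro cfun.subspace_sum cfun.subspace_scale prod_fun_in_H_space pencil_in_H1) auto
  have "0 < CARD('n)"
    by simp
  then have a: "a1 * a2 \<notin> p_powers" "a1 / a2 \<notin> p_powers"
    using generic_params_independent[OF gen nz, of 0 0] by auto
  obtain c where c: "\<And>s. s \<le> CARD('n) \<Longrightarrow> (\<Sum>m\<le>CARD('n). c m * g m (ref_point a1 a2 t s)) = b s"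
  proof (rule injective_square_system_solvable[of "CARD('n)" "\<lambda>m s. g m (ref_point a1 a2 t s)" b])
    fix c assume "\<And>s. s \<le> CARD('n) \<Longrightarrow> (\<Sum>m\<le>CARD('n). c m * g m (ref_point a1 a2 t s)) = 0"
    then have "F c = 0"
      using F nz gen by (intro H_space_zero_if_zero_at_ref_points) (simp_all add: F_apply)
    then have "(\<Sum>m\<le>CARD('n). c m * g m z) = 0" for z
      using F_apply[of c z] by simp
    then show "\<forall>m\<le>CARD('n). c m = 0"
      using prod_fun_pencil_independent[OF nz(1,2) a] unfolding g_def by blast
  qed auto
  show ?thesis
    by (rule that[of "F c"]) (use F c in \<open>auto simp: F_apply\<close>)
qed

text \<open>
  Evaluation at the reference points reads off coefficients, which gives independence. An \<open>f\<close> in the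
  space agrees at the reference points with the combination having its values there as coefficients,
  so it equals that combination.
\<close>

lemma dual_family_is_basis:
  fixes E :: "nat \<Rightarrow> (complex, 'n::{finite,linorder}) vec \<Rightarrow> complex"
  assumes nz: "a1 \<noteq> 0" "a2 \<noteq> 0" "t \<noteq> 0"
    and gen: "generic_params CARD('n) p t a1 a2"
    and E: "\<And>r. r \<le> CARD('n) \<Longrightarrow> E r \<in> H_space p"
    and dual: "\<And>r s. r \<le> CARD('n) \<Longrightarrow> s \<le> CARD('n) \<Longrightarrow>
      E r (ref_point a1 a2 t s) = (if r = s then 1 else 0)"
  shows "is_basis_family {0..CARD('n)} E (H_space p)"
proof -
  let ?N = "CARD('n)"
  have eval: "(\<Sum>r\<in>{0..?N}. cscale (c r) (E r)) (ref_point a1 a2 t s) = c s" if "s \<le> ?N" for c s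
  proof -
    have "(\<Sum>r\<in>{0..?N}. cscale (c r) (E r)) (ref_point a1 a2 t s)
        = (\<Sum>r\<in>{0..?N}. c r * (if r = s then 1 else 0))"
      using that dual by (auto simp: fun_sum_apply cscale_def intro!: sum.cong)
    also have "\<dots> = c s"
      using that by (simp add: if_distrib[of "\<lambda>x. _ * x"] cong: if_cong)
    finally show ?thesis .
  qed
  have inj: "inj_on E {0..?N}"
  proof (rule inj_onI)
    fix r s assume "r \<in> {0..?N}" "s \<in> {0..?N}" "E r = E s"
    then show "r = s"
      using dual[of r s] dual[of s s] by (auto split: if_splits)
  qed
  have "cfun.independent (E ` {0..?N})"
  proof (rule cfun.independent_if_scalars_zero)
    fix u x assume u: "(\<Sum>x\<in>E ` {0..?N}. cscale (u x) x) = 0" and "x \<in> E ` {0..?N}"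
    then obtain s where s: "s \<le> ?N" "x = E s"
      by auto
    have "(\<Sum>r\<in>{0..?N}. cscale (u (E r)) (E r)) = 0"
      using u by (simp add: sum.reindex[OF inj])
    then show "u x = 0"
      using eval[OF s(1), of "\<lambda>r. u (E r)"] s(2) by simp
  qed auto
  moreover have "cfun.span (E ` {0..?N}) = H_space p"
  proof
    show "cfun.span (E ` {0..?N}) \<subseteq> H_space p"
      using E subspace_H_space by (intro cfun.span_minimal) auto
    show "H_space p \<subseteq> cfun.span (E ` {0..?N})"
    proof
      fix f :: "(complex, 'n) vec \<Rightarrow> complex" assume f: "f \<in> H_space p"
      define F where "F = (\<Sum>r\<in>{0..?N}. cscale (f (ref_point a1 a2 t r)) (E r))"
      have F: "F \<in> H_space p"
        unfolding F_def using E subspace_H_space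
        by (intro cfun.subspace_sum cfun.subspace_scale) auto
      have "f - F = 0"
        using f F nz gen subspace_H_space eval
        by (intro H_space_zero_if_zero_at_ref_points cfun.subspace_diff) (auto simp: F_def)
      then have "f = F" by simp
      also have "F \<in> cfun.span (E ` {0..?N})"
        unfolding F_def by (intro cfun.span_sum cfun.span_scale cfun.span_base) auto
      finally show "f \<in> cfun.span (E ` {0..?N})" .
    qed
  qed
  ultimately show ?thesis
    using inj by (simp add: is_basis_family_def)
qed

end

theorem theorem3p1:
  fixes p t a1 a2 :: complex
  assumes "0 < norm p" and "norm p < 1"
    and "a1 \<noteq> 0" and "a2 \<noteq> 0" and "t \<noteq> 0"
    and "generic_params CARD('n::{finite,linorder}) p t a1 a2"
  shows "\<exists>!E :: nat \<Rightarrow> (complex, 'n::{finite,linorder}) vec \<Rightarrow> complex.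
           E \<in> extensional {0..CARD('n::{finite,linorder})} \<and>
           is_basis_family {0..CARD('n::{finite,linorder})} E (H_space p) \<and>
           (\<forall>r\<in>{0..CARD('n::{finite,linorder})}. \<forall>s\<in>{0..CARD('n::{finite,linorder})}.
              E r (ref_point a1 a2 t s) = (if r = s then 1 else 0))"
proof -
  interpret nome p
    using assms by unfold_locales
  let ?N = "CARD('n)"
  note params = assms(3-6)
  have "\<exists>f :: (complex, 'n) vec \<Rightarrow> complex. f \<in> H_space p \<and>
      (\<forall>s\<le>?N. f (ref_point a1 a2 t s) = (if r = s then 1 else 0))" for r
    using H_space_interpolation[OF params, of "\<lambda>s. if r = s then 1 else 0"] by metis
  then obtain e :: "nat \<Rightarrow> (complex, 'n) vec \<Rightarrow> complex" where
    e: "\<And>r. e r \<in> H_space p"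
       "\<And>r s. s \<le> ?N \<Longrightarrow> e r (ref_point a1 a2 t s) = (if r = s then 1 else 0)"
    by metis
  define E where "E = restrict e {0..?N}"
  show ?thesis
  proof (rule ex1I[of _ E], intro conjI ballI)
    show "E \<in> extensional {0..?N}"
      by (simp add: E_def)
    show "is_basis_family {0..?N} E (H_space p)"
      using e by (intro dual_family_is_basis[OF params]) (auto simp: E_def)
    show "E r (ref_point a1 a2 t s) = (if r = s then 1 else 0)"
      if "r \<in> {0..?N}" "s \<in> {0..?N}" for r s
      using e that by (simp add: E_def)
  next
    fix E' :: "nat \<Rightarrow> (complex, 'n) vec \<Rightarrow> complex"
    assume E': "E' \<in> extensional {0..?N} \<and> is_basis_family {0..?N} E' (H_space p) \<and>
      (\<forall>r\<in>{0..?N}. \<forall>s\<in>{0..?N}. E' r (ref_point a1 a2 t s) = (if r = s then 1 else 0))"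
    show "E' = E"
    proof (rule extensionalityI)
      show "E' \<in> extensional {0..?N}" "E \<in> extensional {0..?N}"
        using E' by (auto simp: E_def)
      fix r assume r: "r \<in> {0..?N}"
      have "E' r \<in> H_space p"
        using E' r cfun.span_base[of "E' r" "E' ` {0..?N}"] by (auto simp: is_basis_family_def)
      then have "E' r - e r = 0"
        using e E' r params subspace_H_space
        by (intro H_space_zero_if_zero_at_ref_points cfun.subspace_diff) auto
      then show "E' r = E r"
        using r by (simp add: E_def)
    qed
  qed
qed

end
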